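(* Let $\alpha\in(0,1]$, $\beta\ge1-\alpha$, $A\in\mathbb{R}^{n\times n}$, $B\in\mathbb{R}^{n\times m}$ with $\operatorname{rank}B=n$, and let $\psi$ be the initialization function of the system $\Sigma_{\alpha,\psi}$. Let $B^+$ be a matrix such that $BB^+=I$, and let $g_\beta(\cdot)$ be a matrix function such that $\Phi_\beta(t)g_\beta(t)=I$ for $t>0$ and $\lim_{t\to0+}\Phi_\beta(t)g_\beta(t)=I$. Let $T>0$ and $b\in\mathbb{R}^n$. Then the control $$\widehat u(t)=\frac1T\,B^+g_\beta(T-t)\Bigl(b+\int_0^T\Phi_\beta(T-\tau)\psi(\tau)\,d\tau\Bigr),\qquad t\in[0,T],$$ transfers the system $\Sigma_{\alpha,\psi}$ to $b$ in time $T$, i.e. $M_\beta(T,\psi,\widehat u)=b$.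
   Context: System: $\Sigma_{\alpha,\psi}$ is the initialized fractional linear control system $D^\alpha_{0+}x(t)=Ax(t)+Bu(t)$, $t\ge0$, $x(t)\in\mathbb{R}^n$, $u(t)\in\mathbb{R}^m$, where $D^\alpha_{0+}x={}_0d^\alpha_tx+\psi$, ${}_0d^\alpha_tx=\mathcal{L}^{-1}[s^\alpha\mathcal{L}[x](s)]$ is the uninitialized derivative, and $\psi$ is a given $\mathbb{R}^n$-valued initialization function, integrable on $[0,T]$. Its forward trajectory is $\gamma(t,\psi,u)=\int_0^te_\alpha^{A(t-\tau)}(Bu(\tau)-\psi(\tau))\,d\tau$, with $e_\alpha^{At}=\sum_{k\ge0}A^k\frac{t^{(k+1)\alpha-1}}{\Gamma((k+1)\alpha)}$. The memory of order $\beta$ is $M_\beta(t,\psi,u)=I^\beta_{0+}\gamma(t,\psi,u)$, where $I^\beta_{0+}\varphi(t)=\frac1{\Gamma(\beta)}\int_0^t\varphi(\tau)(t-\tau)^{\beta-1}d\tau$ for $\beta>0$ and $I^0_{0+}$ is the identity; it is given by, and here understood as, $$M_\beta(t,\psi,u)=\int_0^t\Phi_\beta(t-\tau)\bigl(Bu(\tau)-\psi(\tau)\bigr)d\tau,\qquad \Phi_\beta(t)=t^{\alpha+\beta-1}\sum_{k=0}^\infty A^k\frac{t^{k\alpha}}{\Gamma((k+1)\alpha+\beta)} .$$ *)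

theory Defs
  imports "HOL-Analysis.Analysis"
begin

text \<open>Real power of a base \<open>t \<ge> 0\<close> with the convention \<open>0\<^sup>0 = 1\<close> customary in power series;
  the library has \<open>0 powr 0 = 0\<close>.\<close>

definition rpow :: "real \<Rightarrow> real \<Rightarrow> real" where
  "rpow t p = (if p = 0 then 1 else t powr p)"

text \<open>The overloaded \<open>(^)\<close> on \<open>real ^ 'n ^ 'n\<close> is taken entrywise, so powers with respect to the
  matrix product are introduced here.\<close>

primrec matrix_power :: "real ^ 'n ^ 'n \<Rightarrow> nat \<Rightarrow> real ^ 'n ^ 'n" where
  "matrix_power A 0 = mat 1"
| "matrix_power A (Suc k) = A ** matrix_power A k"

definition Phi :: "real \<Rightarrow> real \<Rightarrow> real ^ 'n ^ 'n \<Rightarrow> real \<Rightarrow> real ^ 'n ^ 'n" where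
  "Phi \<alpha> \<beta> A t = rpow t (\<alpha> + \<beta> - 1) *\<^sub>R
     (\<Sum>k. (rpow t (real k * \<alpha>) / Gamma ((real k + 1) * \<alpha> + \<beta>)) *\<^sub>R matrix_power A k)"

definition memory_integrand ::
  "real \<Rightarrow> real \<Rightarrow> real ^ 'n ^ 'n \<Rightarrow> real ^ 'm ^ 'n \<Rightarrow> real \<Rightarrow>
   (real \<Rightarrow> real ^ 'n) \<Rightarrow> (real \<Rightarrow> real ^ 'm) \<Rightarrow> real \<Rightarrow> real ^ 'n" where
  "memory_integrand \<alpha> \<beta> A B t \<psi> u \<tau> = Phi \<alpha> \<beta> A (t - \<tau>) *v (B *v u \<tau> - \<psi> \<tau>)"

definition memory ::
  "real \<Rightarrow> real \<Rightarrow> real ^ 'n ^ 'n \<Rightarrow> real ^ 'm ^ 'n \<Rightarrow> real \<Rightarrow>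
   (real \<Rightarrow> real ^ 'n) \<Rightarrow> (real \<Rightarrow> real ^ 'm) \<Rightarrow> real ^ 'n" where
  "memory \<alpha> \<beta> A B t \<psi> u = (LINT \<tau>:{0..t}|lebesgue. memory_integrand \<alpha> \<beta> A B t \<psi> u \<tau>)"

text \<open>The Bochner integral of a non-integrable function is \<open>0\<close> by convention, so the existence of
  the integral defining the memory is stated explicitly.\<close>

definition transfers ::
  "real \<Rightarrow> real \<Rightarrow> real ^ 'n ^ 'n \<Rightarrow> real ^ 'm ^ 'n \<Rightarrow> (real \<Rightarrow> real ^ 'n) \<Rightarrow>
   (real \<Rightarrow> real ^ 'm) \<Rightarrow> real ^ 'n \<Rightarrow> real \<Rightarrow> bool" where
  "transfers \<alpha> \<beta> A B \<psi> u b T \<longleftrightarrow>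
     set_integrable lebesgue {0..T} (memory_integrand \<alpha> \<beta> A B T \<psi> u) \<and>
     memory \<alpha> \<beta> A B T \<psi> u = b"

end

theory Submission
  imports Defs
begin

text \<open>Since \<open>\<Phi>\<^sub>\<beta>(T - \<tau>) g\<^sub>\<beta>(T - \<tau>) = I\<close> for \<open>\<tau> < T\<close>, the control makes the memory integrand equal to
  \<open>(b + J)/T - \<Phi>\<^sub>\<beta>(T - \<tau>) \<psi>(\<tau>)\<close> off the single point \<open>\<tau> = T\<close>, where \<open>J\<close> is the integral of the
  subtracted term. What has to be justified is that this term is integrable: the exponent
  \<open>\<alpha> + \<beta> - 1\<close> is nonnegative and the Mittag-Leffler type series converges uniformly on \<open>[0, T]\<close>,
  so \<open>\<Phi>\<^sub>\<beta>\<close> is continuous there.\<close>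

text \<open>Euler's integral has a nonnegative integrand, so it dominates its part over the unit
  interval from \<open>R\<close> to \<open>R + 1\<close>. There the numerator is least at the left
  end, because \<open>x - 1\<close> is nonnegative, and \<open>exp\<close> is greatest at the right
  end.\<close>

lemma Gamma_ge_powr:
  fixes x R :: real
  assumes "x \<ge> 1" "R \<ge> 0"
  shows "R powr (x - 1) / exp (R + 1) \<le> Gamma x"
proof -
  let ?f = "\<lambda>t::real. t powr (x - 1) / exp t"
  have f: "(?f has_integral Gamma x) {0..}"
    using assms by (intro Gamma_integral_real) auto
  have c: "((\<lambda>t::real. R powr (x - 1) / exp (R + 1)) has_integral
      R powr (x - 1) / exp (R + 1)) {R..R+1}"
    using has_integral_const_real[of "R powr (x - 1) / exp (R + 1)" R "R + 1"] by simp
  have int: "?f integrable_on {R..R+1}"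
    using f assms by (intro integrable_on_subinterval[of ?f "{0..}"]) auto
  have "R powr (x - 1) / exp (R + 1) \<le> integral {R..R+1} ?f"
  proof (rule has_integral_le[OF c integrable_integral[OF int]])
    fix t assume t: "t \<in> {R..R+1}"
    show "R powr (x - 1) / exp (R + 1) \<le> ?f t"
      using t assms by (intro frac_le powr_mono2) auto
  qed
  also have "\<dots> \<le> integral {0..} ?f"
    using f int assms by (intro integral_subset_le) auto
  also have "\<dots> = Gamma x"
    using f by blast
  finally show ?thesis .
qed

text \<open>The base \<open>R\<close> in \<open>Gamma_ge_powr\<close> is free, so
  \<open>Gamma\<close> along an arithmetic progression outgrows any geometric sequence. This yields
  the majorant for the series in \<open>Phi\<close>.\<close>

lemma summable_power_divide_Gamma:
  fixes q a c :: real
  assumes "q > 0" "a > 0" "c \<ge> 1"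
  shows "summable (\<lambda>k. q ^ k / Gamma (real k * a + c))"
proof -
  \<comment> \<open>With this choice \<open>R powr (a * real k)\<close> is
    \<open>(2 * q) ^ k\<close>, which leaves the ratio 1/2 after division; \<open>K\<close> collects
    the factors independent of \<open>k\<close>.\<close>
  define R where "R = (2 * q) powr (1 / a)"
  have R: "R > 0" "R powr a = 2 * q"
    using assms by (simp_all add: R_def powr_powr)
  define K where "K = exp (R + 1) / R powr (c - 1)"
  have "norm (q ^ k / Gamma (real k * a + c)) \<le> K * (1/2) ^ k" for k
  proof -
    have "R powr (real k * a + c - 1) = R powr (c - 1) * R powr (a * real k)"
      by (simp add: powr_add[symmetric] algebra_simps)
    also have "R powr (a * real k) = (2 * q) ^ k"
      using R assms by (metis powr_powr powr_realpow mult_pos_pos zero_less_numeral)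
    finally have "R powr (real k * a + c - 1) = R powr (c - 1) * (2 * q) ^ k" .
    then have G: "R powr (c - 1) * (2 * q) ^ k / exp (R + 1) \<le> Gamma (real k * a + c)"
      using Gamma_ge_powr[of "real k * a + c" R] assms R(1) by (simp add: add_increasing)
    have pos: "0 < R powr (c - 1) * (2 * q) ^ k / exp (R + 1)"
      using R assms by simp
    have "q ^ k / Gamma (real k * a + c) \<le> q ^ k / (R powr (c - 1) * (2 * q) ^ k / exp (R + 1))"
      using G pos assms by (intro divide_left_mono mult_pos_pos) auto
    also have "\<dots> = K * (1/2) ^ k"
      using assms by (simp add: K_def power_mult_distrib field_simps)
    finally show ?thesis
      using G pos assms by simp
  qed
  moreover have "summable (\<lambda>k. K * (1/2) ^ k)"
    by (rule summable_mult[OF summable_geometric]) simp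
  ultimately show ?thesis
    by (rule summable_comparison_test'[rotated])
qed

text \<open>The delicate point is \<open>t = 0\<close>: a positive exponent gives the value 0 there,
  and for \<open>p = 0\<close> the convention makes the function constantly 1.\<close>

lemma continuous_on_rpow:
  assumes "p \<ge> 0"
  shows "continuous_on {0..} (\<lambda>t. rpow t p)"
proof (cases "p = 0")
  case False
  then have "continuous_on {0..} (\<lambda>t::real. t powr p)"
    using assms by (intro continuous_on_powr' continuous_on_id continuous_on_const) auto
  with False show ?thesis by (simp add: rpow_def)
qed (simp add: rpow_def)

text \<open>Left multiplication by \<open>A\<close> is a bounded linear map, and \<open>C\<close> is
  a bound for it. The factor \<open>norm (mat 1)\<close> stays because the Euclidean norm of the
  identity matrix need not be 1.\<close>

lemma matrix_power_norm_bound: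
  fixes A :: "real ^ 'n ^ 'n"
  obtains C where "C > 0" "\<And>k. norm (matrix_power A k) \<le> norm (mat 1 :: real ^ 'n ^ 'n) * C ^ k"
proof -
  have "linear (\<lambda>X :: real ^ 'n ^ 'n. A ** X)"
    by (rule linearI) (simp_all add: vec_eq_iff matrix_matrix_mult_def sum_distrib_left
        sum.distrib distrib_left mult.left_commute)
  then obtain C where C: "C > 0" "\<And>X :: real ^ 'n ^ 'n. norm (A ** X) \<le> C * norm X"
    by (rule linear_bounded_pos) (rule that)
  have "norm (matrix_power A k) \<le> norm (mat 1 :: real ^ 'n ^ 'n) * C ^ k" for k
  proof (induction k)
    case (Suc k)
    then have "C * norm (matrix_power A k) \<le> C * (norm (mat 1 :: real ^ 'n ^ 'n) * C ^ k)"
      using C by (intro mult_left_mono) auto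
    with C(2)[of "matrix_power A k"] show ?case by (simp add: algebra_simps)
  qed simp
  with C(1) show ?thesis by (rule that)
qed

text \<open>The bound on \<beta> enters twice: it makes the exponent of the prefactor nonnegative,
  and it gives \<alpha> + \<beta> \<ge> 1, as the summability lemma requires.\<close>

lemma continuous_on_Phi:
  fixes A :: "real ^ 'n ^ 'n"
  assumes "\<alpha> > 0" "\<beta> \<ge> 1 - \<alpha>" "T > 0"
  shows "continuous_on {0..T} (Phi \<alpha> \<beta> A)"
proof -
  obtain C where C: "C > 0"
    "\<And>k. norm (matrix_power A k) \<le> norm (mat 1 :: real ^ 'n ^ 'n) * C ^ k"
    using matrix_power_norm_bound[of A] by blast
  let ?G = "\<lambda>k. Gamma (real k * \<alpha> + (\<alpha> + \<beta>))"
  let ?f = "\<lambda>k t. (rpow t (real k * \<alpha>) / Gamma ((real k + 1) * \<alpha> + \<beta>)) *\<^sub>R matrix_power A k"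
  define q where "q = C * T powr \<alpha>"
  have G: "Gamma ((real k + 1) * \<alpha> + \<beta>) = ?G k" "?G k > 0" for k
  proof -
    have "real k * \<alpha> + (\<alpha> + \<beta>) > 0"
      using assms by (simp add: add_nonneg_pos)
    then show "?G k > 0" by (rule Gamma_real_pos)
  qed (simp add: algebra_simps)
  have bound: "norm (?f k t) \<le> norm (mat 1 :: real ^ 'n ^ 'n) * (q ^ k / ?G k)"
    if "t \<in> {0..T}" for k t
  proof -
    \<comment> \<open>For \<open>k = 0\<close> both sides are 1, even at \<open>t = 0\<close>;
      otherwise \<open>powr\<close> is monotone in its base.\<close>
    have "rpow t (real k * \<alpha>) \<le> (T powr \<alpha>) ^ k"
      using that assms powr_mono2[of "real k * \<alpha>" t T]
      by (auto simp: rpow_def powr_powr mult.commute simp flip: powr_realpow)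
    moreover have "rpow t (real k * \<alpha>) \<ge> 0"
      by (auto simp: rpow_def)
    ultimately have "\<bar>rpow t (real k * \<alpha>) / ?G k\<bar> * norm (matrix_power A k) \<le>
        ((T powr \<alpha>) ^ k / ?G k) * (norm (mat 1 :: real ^ 'n ^ 'n) * C ^ k)"
      using G(2)[of k] C by (intro mult_mono) (auto intro!: divide_right_mono)
    then show ?thesis
      unfolding G(1) norm_scaleR q_def power_mult_distrib real_norm_def by (simp only: mult_ac times_divide_eq_left times_divide_eq_right)
  qed
  have "summable (\<lambda>k. norm (mat 1 :: real ^ 'n ^ 'n) * (q ^ k / ?G k))"
    using assms C by (intro summable_mult summable_power_divide_Gamma) (auto simp: q_def)
  with bound have lim: "uniform_limit {0..T} (\<lambda>N t. \<Sum>k<N. ?f k t) (\<lambda>t. \<Sum>k. ?f k t) sequentially"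
    by (rule Weierstrass_m_test)
  have rpow: "continuous_on {0..T} (\<lambda>t. rpow t p)" if "p \<ge> 0" for p
    by (rule continuous_on_subset[OF continuous_on_rpow[OF that]]) auto
  have "continuous_on {0..T} (?f k)" for k
    unfolding divide_inverse using assms(1)
    by (intro continuous_on_scaleR continuous_on_mult continuous_on_const rpow) auto
  then have "continuous_on {0..T} (\<lambda>t. \<Sum>k<N. ?f k t)" for N
    by (rule continuous_on_sum)
  then have "continuous_on {0..T} (\<lambda>t. \<Sum>k. ?f k t)"
    by (intro uniform_limit_theorem[OF _ lim]) auto
  moreover have "continuous_on {0..T} (\<lambda>t. rpow t (\<alpha> + \<beta> - 1))"
    using assms(2) by (intro rpow) simp
  ultimately show ?thesis
    unfolding Phi_def [abs_def] by (intro continuous_on_scaleR)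
qed

text \<open>A continuous kernel on a compact interval is bounded and measurable, so its bilinear
  product with an absolutely integrable function is absolutely integrable.\<close>

lemma absolutely_integrable_Phi_mult:
  fixes A :: "real ^ 'n ^ 'n" and \<psi> :: "real \<Rightarrow> real ^ 'n"
  assumes "\<alpha> > 0" "\<beta> \<ge> 1 - \<alpha>" "T > 0" "\<psi> absolutely_integrable_on {0..T}"
  shows "(\<lambda>\<tau>. Phi \<alpha> \<beta> A (T - \<tau>) *v \<psi> \<tau>) absolutely_integrable_on {0..T}"
proof (rule absolutely_integrable_bounded_measurable_product[where h = "(*v)"])
  have cont: "continuous_on {0..T} (\<lambda>\<tau>. Phi \<alpha> \<beta> A (T - \<tau>))"
    by (rule continuous_on_compose2[OF continuous_on_Phi[OF assms(1-3)]])
       (auto intro!: continuous_intros)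
  then show "(\<lambda>\<tau>. Phi \<alpha> \<beta> A (T - \<tau>)) \<in> borel_measurable (lebesgue_on {0..T})"
    by (rule continuous_imp_measurable_on_sets_lebesgue) auto
  show "bounded ((\<lambda>\<tau>. Phi \<alpha> \<beta> A (T - \<tau>)) ` {0..T})"
    using cont by (intro compact_imp_bounded compact_continuous_image) auto
  show "bilinear ((*v) :: real ^ 'n ^ 'n \<Rightarrow> _)"
    unfolding bilinear_def
    by (auto intro!: linearI simp: matrix_vector_mult_add_rdistrib scaleR_matrix_vector_assoc)
  show "{0..T} \<in> sets lebesgue" by simp
  show "\<psi> absolutely_integrable_on {0..T}" by fact
qed

theorem proposition4p1:
  fixes \<alpha> \<beta> T :: real
    and A :: "real ^ 'n ^ 'n"
    and B :: "real ^ 'm ^ 'n"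
    and Bp :: "real ^ 'n ^ 'm"
    and g :: "real \<Rightarrow> real ^ 'n ^ 'n"
    and \<psi> :: "real \<Rightarrow> real ^ 'n"
    and u :: "real \<Rightarrow> real ^ 'm"
    and b :: "real ^ 'n"
  assumes "0 < \<alpha>" and "\<alpha> \<le> 1" and "\<beta> \<ge> 1 - \<alpha>"
    and "rank B = CARD('n)"
    and "B ** Bp = mat 1"
    and "\<And>t. t > 0 \<Longrightarrow> Phi \<alpha> \<beta> A t ** g t = mat 1"
    and "((\<lambda>t. Phi \<alpha> \<beta> A t ** g t) \<longlongrightarrow> mat 1) (at_right 0)"
    and "T > 0"
    and "set_integrable lebesgue {0..T} \<psi>"
    and "\<And>t. t \<in> {0..T} \<Longrightarrow>
           u t = (1 / T) *\<^sub>R ((Bp ** g (T - t)) *v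
             (b + (LINT \<tau>:{0..T}|lebesgue. Phi \<alpha> \<beta> A (T - \<tau>) *v \<psi> \<tau>)))"
  shows "transfers \<alpha> \<beta> A B \<psi> u b T"
proof -
  let ?h = "\<lambda>\<tau>. Phi \<alpha> \<beta> A (T - \<tau>) *v \<psi> \<tau>"
  define J where "J = (LINT \<tau>:{0..T}|lebesgue. ?h \<tau>)"
  define k where "k = (\<lambda>\<tau>. (1 / T) *\<^sub>R (b + J) - ?h \<tau>)"
  have h: "?h absolutely_integrable_on {0..T}"
    using assms by (intro absolutely_integrable_Phi_mult) auto
  have c: "(\<lambda>\<tau>. (1 / T) *\<^sub>R (b + J)) absolutely_integrable_on {0..T}"
    by (rule absolutely_integrable_on_const) auto
  have k: "k absolutely_integrable_on {0..T}"
    unfolding k_def by (rule set_integral_diff(1)[OF c h])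
  \<comment> \<open>The factor \<open>1 / T\<close> cancels the length of the interval.\<close>
  have "integral {0..T} k = (b + J) - J"
    unfolding k_def J_def using \<open>T > 0\<close> set_lebesgue_integral_eq_integral[OF h]
      set_lebesgue_integral_eq_integral[OF c]
    by (subst Henstock_Kurzweil_Integration.integral_diff) auto
  then have k_int: "integral {0..T} k = b" by simp
  \<comment> \<open>At \<open>T\<close> the argument of \<open>g\<close> is 0, where its value is
    unconstrained; a single point is negligible for the integral.\<close>
  have eq: "memory_integrand \<alpha> \<beta> A B T \<psi> u \<tau> = k \<tau>" if "\<tau> \<in> {0..T} - {T}" for \<tau>
  proof -
    have u: "u \<tau> = (1 / T) *\<^sub>R ((Bp ** g (T - \<tau>)) *v (b + J))"
      using assms(10)[of \<tau>] that by (simp add: J_def)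
    have "Phi \<alpha> \<beta> A (T - \<tau>) *v (B *v u \<tau>) =
        (1 / T) *\<^sub>R ((Phi \<alpha> \<beta> A (T - \<tau>) ** (B ** Bp) ** g (T - \<tau>)) *v (b + J))"
      by (simp only: u matrix_vector_mult_scaleR matrix_vector_mul_assoc matrix_mul_assoc)
    also have "\<dots> = (1 / T) *\<^sub>R (b + J)"
      using assms(5) assms(6)[of "T - \<tau>"] that by simp
    finally show ?thesis
      by (simp add: memory_integrand_def k_def matrix_vector_mult_diff_distrib)
  qed
  have m: "memory_integrand \<alpha> \<beta> A B T \<psi> u absolutely_integrable_on {0..T}"
    using eq by (intro absolutely_integrable_spike[OF k, of "{T}"]) auto
  \<comment> \<open>Absolute integrability identifies the Lebesgue integral with the gauge integral,
    for which \<open>integral_spike\<close> discards the endpoint.\<close>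
  have "memory \<alpha> \<beta> A B T \<psi> u = integral {0..T} (memory_integrand \<alpha> \<beta> A B T \<psi> u)"
    unfolding memory_def using m by (rule set_lebesgue_integral_eq_integral(2))
  also have "\<dots> = integral {0..T} k"
    using eq by (intro integral_spike[of "{T}"]) auto
  finally show ?thesis
    using m k_int by (simp add: transfers_def)
qed

end
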